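(* Let $a,\theta,p,z\in\mathbb{C}$ with $-2a\notin\mathbb{N}\cup\{0\}$, $|z|<\frac1{|\theta|}$ and $|\arg(1-\theta z)|<\pi$. Then $$(1-\theta z)^p\,I_{a-\frac12}(z)=\sum_{n=0}^\infty a_nz^{\,n+a-\frac12},\qquad a_n=\frac{4^{\frac12-a}}{\Gamma(a+\frac12)}\sum_{k=0}^n\frac{(-1)^ku_{n-k}}{2^kk!},$$ where $u_0=1$, $u_1=\frac12-\theta p$, $u_2=\frac12\left(\frac{a+1}{2a+1}-\theta p+\theta^2(p-1)p\right)$ and, for $n\ge2$, $$u_{n+1}=\beta_0(n)u_n+\beta_1(n)u_{n-1}+\beta_2(n)u_{n-2},$$ with \begin{align*} \beta_0(n)&=\frac{a+2\theta n(2a+n-1)-\theta p(2a+2n)+n}{(n+1)(2a+n)},\\ \beta_1(n)&=\frac{\theta\left(-2a-\theta(n-p-1)(2a+n-p-2)-2n+p+2\right)}{(n+1)(2a+n)},\\ \beta_2(n)&=\frac{\theta^2(a+n-p-2)}{(n+1)(2a+n)}. \end{align*}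
   Context: $I_\alpha$ is the modified Bessel function, $I_\alpha(x)=\sum_{m=0}^\infty\frac{1}{m!\,\Gamma(m+\alpha+1)}\left(\frac x2\right)^{2m+\alpha}$. Powers are principal branches.
   Formalization: The printed identity is false (for a=1, p=0 the leading coefficients differ); it is proved with I_{a-1/2}(z/2) in place of I_{a-1/2}(z) and with (a+1)/(2(2a+1)) in place of (a+1)/(2a+1) in u_2. *)

theory Defs
  imports "HOL-Analysis.Analysis"
begin

text \<open>
  Principal branch of the complex power. It is \<^const>\<open>powr\<close> except that \<open>0 powr 0 = 0\<close>
  is replaced by the value \<open>1\<close> needed in power series such as \<open>I\<^sub>0\<close>. For \<open>w \<noteq> 0\<close> we
  have \<open>cpow 0 w = 0\<close>, which is a mere convention unless \<open>Re w > 0\<close>.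
\<close>

definition cpow :: "complex \<Rightarrow> complex \<Rightarrow> complex" where
  "cpow z w = (if z = 0 \<and> w = 0 then 1 else z powr w)"

text \<open>
  At the poles of \<^const>\<open>Gamma\<close> the summand is \<open>0\<close>, as it should be: there \<open>Gamma\<close> is
  \<open>0\<close> by convention, and so is the inverse of \<open>0\<close>.
\<close>

definition bessel_I :: "complex \<Rightarrow> complex \<Rightarrow> complex" where
  "bessel_I \<alpha> x =
     (\<Sum>m. 1 / (fact m * Gamma (of_nat m + \<alpha> + 1)) * cpow (x / 2) (2 * of_nat m + \<alpha>))"

text \<open>
  Coefficients of the four-term recurrence satisfied by the Taylor coefficients at \<open>0\<close> of
  \<open>(1 - \<theta> z)\<^sup>p M(a, 2a, z)\<close>, where \<open>M\<close> is Kummer's function. They are linked to the Bessel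
  function at \<open>z / 2\<close> by
  \<open>exp (- z / 2) M(a, 2a, z) = Gamma (a + 1/2) (z / 4) powr (1/2 - a) I\<^bsub>a - 1/2\<^esub>(z / 2)\<close>.
\<close>

definition beta0 :: "complex \<Rightarrow> complex \<Rightarrow> complex \<Rightarrow> nat \<Rightarrow> complex" where
  "beta0 a \<theta> p n =
     (a + 2 * \<theta> * of_nat n * (2 * a + of_nat n - 1) - \<theta> * p * (2 * a + 2 * of_nat n) + of_nat n)
       / ((of_nat n + 1) * (2 * a + of_nat n))"

definition beta1 :: "complex \<Rightarrow> complex \<Rightarrow> complex \<Rightarrow> nat \<Rightarrow> complex" where
  "beta1 a \<theta> p n =
     \<theta> * (- 2 * a - \<theta> * (of_nat n - p - 1) * (2 * a + of_nat n - p - 2) - 2 * of_nat n + p + 2)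
       / ((of_nat n + 1) * (2 * a + of_nat n))"

definition beta2 :: "complex \<Rightarrow> complex \<Rightarrow> complex \<Rightarrow> nat \<Rightarrow> complex" where
  "beta2 a \<theta> p n =
     \<theta>\<^sup>2 * (a + of_nat n - p - 2) / ((of_nat n + 1) * (2 * a + of_nat n))"

text \<open>
  The Taylor coefficients of \<open>(1 - \<theta> z)\<^sup>p M(a, 2a, z)\<close>. The source prints \<open>(a + 1) / (2 * a + 1)\<close> in
  the third equation; the coefficient \<open>(a + 1) / (4 * (2 * a + 1))\<close> of \<open>z\<^sup>2\<close> in \<open>M(a, 2a, z)\<close>
  requires the additional factor \<open>2\<close> in the denominator. The source also prints the Bessel function
  at \<open>z\<close>, where its own normalisation of \<open>bessel_coeff\<close> below belongs to the argument \<open>z / 2\<close>.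
\<close>

fun kummer_u :: "complex \<Rightarrow> complex \<Rightarrow> complex \<Rightarrow> nat \<Rightarrow> complex" where
  "kummer_u a \<theta> p 0 = 1"
| "kummer_u a \<theta> p (Suc 0) = 1 / 2 - \<theta> * p"
| "kummer_u a \<theta> p (Suc (Suc 0)) =
     1 / 2 * ((a + 1) / (2 * (2 * a + 1)) - \<theta> * p + \<theta>\<^sup>2 * (p - 1) * p)"
| "kummer_u a \<theta> p (Suc (Suc (Suc n))) =
     beta0 a \<theta> p (Suc (Suc n)) * kummer_u a \<theta> p (Suc (Suc n))
     + beta1 a \<theta> p (Suc (Suc n)) * kummer_u a \<theta> p (Suc n)
     + beta2 a \<theta> p (Suc (Suc n)) * kummer_u a \<theta> p n"

definition bessel_coeff :: "complex \<Rightarrow> complex \<Rightarrow> complex \<Rightarrow> nat \<Rightarrow> complex" where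
  "bessel_coeff a \<theta> p n =
     4 powr (1 / 2 - a) / Gamma (a + 1 / 2)
       * (\<Sum>k=0..n. (-1) ^ k * kummer_u a \<theta> p (n - k) / (2 ^ k * fact k))"

end

theory Submission
  imports Defs
begin

text \<open>
  Put \<open>b = a + 1/2\<close>. Pulling the power of \<open>z\<close> out of the Bessel series leaves an even entire function:
  \<open>I\<^bsub>a - 1/2\<^esub>(z / 2) = 4 powr (1/2 - a) / Gamma b * z powr (a - 1/2) * K(z)\<close> with
  \<open>K(z) = \<Sum>m. (z / 4)\<^bsup>2 m\<^esup> / (m! (b)\<^sub>m)\<close>, where \<open>(b)\<^sub>m\<close> is the Pochhammer symbol. Let \<open>B\<close> be the
  binomial series of \<open>(1 - \<theta> z)\<^sup>p\<close>. Both series converge on \<open>\<bar>\<theta> z\<bar> < 1\<close>, and so does their product,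
  so the theorem amounts to computing the coefficients of \<open>B K\<close>.

  These are found through \<open>F = B exp(z / 2) K\<close>: its coefficients are the numbers \<^const>\<open>kummer_u\<close>,
  and \<open>B K = exp(-z / 2) F\<close> turns into the sum that defines \<^const>\<open>bessel_coeff\<close>. The recurrence for
  \<open>F\<close> comes from differential equations between formal power series. The modified Bessel equation
  takes the form \<open>z K'' + 2 a K' = z K / 4\<close> and becomes Kummer's equation
  \<open>z M'' + (2 a - z) M' - a M = 0\<close> for \<open>M = exp(z / 2) K\<close>, which is Kummer's function
  \<open>M(a, 2 a, z)\<close>. Since \<open>(1 - \<theta> z) B' = - p \<theta> B\<close>, multiplying by \<open>B\<close> gives a second-order equation
  with polynomial coefficients for \<open>F = B M\<close> (lemma \<open>binomial_times_deriv2\<close>). Its coefficient at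
  \<open>z\<^sup>n\<close> is the recurrence multiplied by \<open>(n + 1) (2 a + n)\<close>, which is nonzero because \<open>- 2 a\<close> is not
  a natural number; so \<open>F\<close> is determined by its constant term
  (lemma \<open>fps_solution_eq_kummer_u\<close>).
\<close>

section \<open>The differential equations of the three factors\<close>

definition binomial_series :: "complex \<Rightarrow> complex \<Rightarrow> complex fps" where
  "binomial_series \<theta> p = Abs_fps (\<lambda>n. (p gchoose n) * (- \<theta>) ^ n)"

lemma binomial_series_deriv:
  "(1 - fps_const \<theta> * fps_X) * fps_deriv (binomial_series \<theta> p) =
     fps_const (- (p * \<theta>)) * binomial_series \<theta> p"
proof (rule fps_ext)
  fix n
  have absorb: "of_nat (Suc n) * (p gchoose Suc n) = (p - of_nat n) * (p gchoose n)"
    using gbinomial_mult_1[of p n] by (simp add: left_diff_distrib)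
  have lhs: "fps_nth ((1 - fps_const \<theta> * fps_X) * fps_deriv (binomial_series \<theta> p)) n
      = of_nat (Suc n) * (p gchoose Suc n) * (- \<theta>) ^ Suc n
        - \<theta> * (of_nat n * (p gchoose n) * (- \<theta>) ^ n)"
    by (cases n) (simp_all add: binomial_series_def left_diff_distrib mult.assoc del: of_nat_Suc)
  have rhs: "fps_nth (fps_const (- (p * \<theta>)) * binomial_series \<theta> p) n
      = - (p * \<theta>) * ((p gchoose n) * (- \<theta>) ^ n)"
    by (simp add: binomial_series_def)
  show "fps_nth ((1 - fps_const \<theta> * fps_X) * fps_deriv (binomial_series \<theta> p)) n =
          fps_nth (fps_const (- (p * \<theta>)) * binomial_series \<theta> p) n"
    unfolding lhs rhs absorb by (simp add: algebra_simps)
qed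

text \<open>
  The series \<open>K\<close> above. The constant \<open>16 = 4\<^sup>2\<close> comes from the argument \<open>(z / 2) / 2\<close> of the powers
  in the Bessel function at \<open>z / 2\<close>.
\<close>

definition reduced_bessel_series :: "complex \<Rightarrow> complex fps" where
  "reduced_bessel_series a = Abs_fps (\<lambda>n. if odd n then 0 else
     1 / (16 ^ (n div 2) * fact (n div 2) * pochhammer (a + 1 / 2) (n div 2)))"

lemma two_a_plus_nat_nonzero:
  fixes a :: complex
  assumes "- 2 * a \<notin> \<nat>"
  shows "2 * a + of_nat n \<noteq> 0"
proof
  assume "2 * a + of_nat n = 0"
  hence "- 2 * a = of_nat n" by (simp add: algebra_simps add_eq_0_iff)
  with assms show False by simp
qed

text \<open>
  At the odd natural values of \<open>- 2 a\<close>, the Gamma function has a pole at \<open>a + 1 / 2\<close> and the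
  denominators of \<open>K\<close> vanish from some index on.
\<close>

lemma a_plus_half_plus_nat_nonzero:
  fixes a :: complex
  assumes "- 2 * a \<notin> \<nat>"
  shows "a + 1 / 2 + of_nat n \<noteq> 0"
proof
  assume "a + 1 / 2 + of_nat n = 0"
  hence "2 * (a + 1 / 2 + of_nat n) = 0" by simp
  hence "2 * a + of_nat (2 * n + 1) = 0" by (simp add: algebra_simps)
  thus False using two_a_plus_nat_nonzero[OF assms] by blast
qed

text \<open>
  The modified Bessel equation for \<open>K\<close>. In terms of coefficients it says
  \<open>4 (n + 2) (n + 1 + 2 a) K\<^bsub>n+2\<^esub> = K\<^sub>n\<close>, and for \<open>n = 2 m\<close> the left factor is
  \<open>16 (m + 1) (a + 1 / 2 + m)\<close>.
\<close>

lemma reduced_bessel_series_deriv2: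
  assumes a: "- 2 * a \<notin> \<nat>"
  shows "fps_X * fps_deriv (fps_deriv (reduced_bessel_series a))
           + fps_const (2 * a) * fps_deriv (reduced_bessel_series a)
         = fps_const (1 / 4) * (fps_X * reduced_bessel_series a)"
proof (rule fps_ext)
  fix n
  let ?K = "reduced_bessel_series a"
  have step: "4 * (of_nat (n + 2) * (of_nat (n + 1) + 2 * a)) * fps_nth ?K (n + 2) = fps_nth ?K n" for n
  proof (cases "even n")
    case True
    then obtain m where n: "n = 2 * m" by blast
    have nz: "pochhammer (a + 1 / 2) m \<noteq> 0"
      using a_plus_half_plus_nat_nonzero[OF a] by (metis pochhammer_eq_0_iff add.left_inverse)
    show ?thesis
      using nz a_plus_half_plus_nat_nonzero[OF a, of m]
      by (simp add: n reduced_bessel_series_def pochhammer_Suc divide_simps del: of_nat_Suc)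
         (simp add: algebra_simps)
  qed (simp add: reduced_bessel_series_def)
  show "fps_nth (fps_X * fps_deriv (fps_deriv ?K) + fps_const (2 * a) * fps_deriv ?K) n
          = fps_nth (fps_const (1 / 4) * (fps_X * ?K)) n"
  proof (cases n)
    case 0
    thus ?thesis by (simp add: reduced_bessel_series_def)
  next
    case (Suc m)
    thus ?thesis using step[of m] by (simp add: algebra_simps)
  qed
qed

text \<open>
  The factor \<open>exp (z / 2)\<close> shifts \<open>d/dz\<close> by \<open>1 / 2\<close>. This trades the term \<open>z K / 4\<close> of the Bessel
  equation for terms of first order and so reduces the equation to Kummer's.
\<close>

lemma exp_times_deriv2:
  fixes K :: "complex fps"
  assumes K: "fps_X * fps_deriv (fps_deriv K) + fps_const (2 * a) * fps_deriv K
                = fps_const (1 / 4) * (fps_X * K)"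
  defines "M \<equiv> fps_exp (1 / 2) * K"
  shows "fps_X * fps_deriv (fps_deriv M) + (fps_const (2 * a) - fps_X) * fps_deriv M
           - fps_const a * M = 0"
proof -
  \<comment> \<open>The constants are made atomic, so that the identity becomes one in a polynomial ring.\<close>
  define h where "h = fps_const (1 / 2 :: complex)"
  define A where "A = fps_const a"
  define E where "E = fps_exp (1 / 2 :: complex)"
  have 4: "fps_const (1 / 4) = h * h" and 2: "fps_const (2 * a) = 2 * A" and h: "2 * h = 1"
    by (simp_all add: h_def A_def fps_numeral_fps_const)
  have E: "fps_deriv E = h * E" by (simp add: E_def h_def)
  have h': "fps_deriv h = 0" by (simp add: h_def)
  have M1: "fps_deriv M = E * fps_deriv K + h * E * K"
    by (simp add: M_def E E_def[symmetric])
  have M2: "fps_deriv (fps_deriv M) = E * fps_deriv (fps_deriv K) + 2 * (h * (E * fps_deriv K)) + h * h * E * K"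
    by (simp add: M1 E h' algebra_simps)
  show ?thesis using K h unfolding M2 unfolding M1 4 2 unfolding M_def E_def[symmetric] A_def[symmetric]
    by algebra
qed

text \<open>
  With \<open>L = 1 - \<theta> z\<close>, the equation \<open>L B' = - p \<theta> B\<close> and its derivative express
  \<open>L (B M)'\<close> and \<open>L\<^sup>2 (B M)''\<close> through \<open>B\<close> times the derivatives of \<open>M\<close>. The left-hand side below is
  \<open>B L\<^sup>2\<close> times Kummer's equation for \<open>M\<close>; the remaining terms
  \<open>\<theta>\<^sup>2 z B M (p (p - 1) - 2 p\<^sup>2 + p (p + 1))\<close> cancel.
\<close>

lemma binomial_times_deriv2:
  fixes M :: "complex fps" and a \<theta> p :: complex
  assumes M: "fps_X * fps_deriv (fps_deriv M) + (fps_const (2 * a) - fps_X) * fps_deriv M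
           - fps_const a * M = 0"
  defines "F \<equiv> binomial_series \<theta> p * M" and "L \<equiv> 1 - fps_const \<theta> * fps_X"
  shows "fps_X * L ^ 2 * fps_deriv (fps_deriv F)
       + (fps_const (2 * p * \<theta>) * fps_X * L + (fps_const (2 * a) - fps_X) * L ^ 2) * fps_deriv F
       + (fps_const (p * (p + 1) * \<theta> ^ 2) * fps_X
          + (fps_const (2 * a) - fps_X) * fps_const (p * \<theta>) * L - fps_const a * L ^ 2) * F = 0"
proof -
  define A P T B where "A = fps_const a" and "P = fps_const p" and "T = fps_const \<theta>"
    and "B = binomial_series \<theta> p"
  have c: "fps_const (2 * a) = 2 * A" "fps_const (2 * p * \<theta>) = 2 * P * T"
    "fps_const (p * (p + 1) * \<theta> ^ 2) = P * (P + 1) * T ^ 2" "fps_const (p * \<theta>) = P * T"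
    by (simp_all add: A_def P_def T_def fps_numeral_fps_const power2_eq_square del: fps_const_add
        flip: fps_const_1_eq_1 fps_const_mult fps_const_add)
  have L': "fps_deriv L = - T" by (simp add: L_def T_def)
  have const: "fps_deriv P = 0" "fps_deriv T = 0" by (simp_all add: P_def T_def)
  have B1: "L * fps_deriv B = - (P * T * B)"
    using binomial_series_deriv[of \<theta> p] unfolding L_def B_def P_def T_def
    by (simp flip: fps_const_neg)
  have "fps_deriv (L * fps_deriv B) = fps_deriv (- (P * T * B))" by (simp only: B1)
  hence B2: "L * fps_deriv (fps_deriv B) = T * fps_deriv B - P * T * fps_deriv B"
    by (simp add: L' const algebra_simps)
  have F1: "fps_deriv F = B * fps_deriv M + fps_deriv B * M"
    by (simp add: F_def B_def)
  have F2: "fps_deriv (fps_deriv F) =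
      B * fps_deriv (fps_deriv M) + 2 * (fps_deriv B * fps_deriv M) + fps_deriv (fps_deriv B) * M"
    by (simp add: F1)
  have M': "fps_X * fps_deriv (fps_deriv M) + (2 * A - fps_X) * fps_deriv M - A * M = 0"
    using M by (simp only: c(1) A_def)
  show ?thesis
    unfolding c F2 unfolding F1 unfolding A_def[symmetric] F_def B_def[symmetric]
    using M' B1 B2 by algebra
qed

section \<open>From the differential equation to the recurrence\<close>

text \<open>
  Expanding the powers of \<open>L\<close> turns the equation into a combination of \<open>z\<^sup>i F\<^bsup>(j)\<^esup>\<close> with \<open>i \<le> 3\<close>,
  so its coefficient at \<open>z\<^sup>n\<close> relates \<open>n + 1\<close> to \<open>n\<close>, \<open>n - 1\<close> and \<open>n - 2\<close>. The
  coefficients at \<open>z\<^sup>0\<close> and \<open>z\<^sup>1\<close>, where some of these indices are missing, give the two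
  initial values beyond \<open>F\<^sub>0 = 1\<close>.
\<close>

lemma fps_solution_eq_kummer_u:
  fixes F :: "complex fps" and a \<theta> p :: complex
  defines "L \<equiv> 1 - fps_const \<theta> * fps_X"
  assumes a: "- 2 * a \<notin> \<nat>" and F0: "fps_nth F 0 = 1"
    and ode: "fps_X * L ^ 2 * fps_deriv (fps_deriv F)
       + (fps_const (2 * p * \<theta>) * fps_X * L + (fps_const (2 * a) - fps_X) * L ^ 2) * fps_deriv F
       + (fps_const (p * (p + 1) * \<theta> ^ 2) * fps_X
          + (fps_const (2 * a) - fps_X) * fps_const (p * \<theta>) * L - fps_const a * L ^ 2) * F = 0"
  shows "fps_nth F n = kummer_u a \<theta> p n"
proof -
  let ?X = "\<lambda>f. fps_X * (f :: complex fps)" and ?c = "\<lambda>x. fps_const (x :: complex)"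
  let ?F' = "fps_deriv F" and ?F'' = "fps_deriv (fps_deriv F)"
  define A P T where "A = fps_const a" and "P = fps_const p" and "T = fps_const \<theta>"
  \<comment> \<open>As constants of the ring of series, the coefficients expand to polynomials in \<open>A\<close>, \<open>P\<close> and \<open>T\<close>.\<close>
  have c: "?c (2 * a) = 2 * A" "?c (2 * p * \<theta>) = 2 * P * T"
    "?c (p * (p + 1) * \<theta> ^ 2) = P * (P + 1) * T ^ 2" "?c (p * \<theta>) = P * T"
    "?c (2 * \<theta>) = 2 * T" "?c (\<theta> ^ 2) = T ^ 2"
    "?c (2 * p * \<theta> - 4 * a * \<theta> - 1) = 2 * P * T - 4 * A * T - 1"
    "?c (- 2 * p * \<theta> ^ 2 + 2 * a * \<theta> ^ 2 + 2 * \<theta>) = - 2 * P * T ^ 2 + 2 * A * T ^ 2 + 2 * T"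
    "?c (2 * a * p * \<theta> - a) = 2 * A * P * T - A"
    "?c (p * (p + 1) * \<theta> ^ 2 - 2 * a * p * \<theta> ^ 2 - p * \<theta> + 2 * a * \<theta>)
       = P * (P + 1) * T ^ 2 - 2 * A * P * T ^ 2 - P * T + 2 * A * T"
    "?c (p * \<theta> ^ 2 - a * \<theta> ^ 2) = P * T ^ 2 - A * T ^ 2"
    by (simp_all add: A_def P_def T_def fps_numeral_fps_const power2_eq_square
        del: fps_const_add fps_const_sub
        flip: fps_const_1_eq_1 fps_const_mult fps_const_add fps_const_sub fps_const_neg)
  have L: "L = 1 - ?X T" by (simp add: L_def T_def mult.commute)
  have "?X ?F'' - ?c (2 * \<theta>) * ?X (?X ?F'') + ?c (\<theta> ^ 2) * ?X (?X (?X ?F''))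
      + ?c (2 * a) * ?F' + ?c (2 * p * \<theta> - 4 * a * \<theta> - 1) * ?X ?F'
      + ?c (- 2 * p * \<theta> ^ 2 + 2 * a * \<theta> ^ 2 + 2 * \<theta>) * ?X (?X ?F') - ?c (\<theta> ^ 2) * ?X (?X (?X ?F'))
      + ?c (2 * a * p * \<theta> - a) * F
      + ?c (p * (p + 1) * \<theta> ^ 2 - 2 * a * p * \<theta> ^ 2 - p * \<theta> + 2 * a * \<theta>) * ?X F
      + ?c (p * \<theta> ^ 2 - a * \<theta> ^ 2) * ?X (?X F) = 0"
    using ode L unfolding c unfolding A_def[symmetric] by algebra
  note coeff = arg_cong[OF this, of "\<lambda>f. fps_nth f _"]
  have nz: "2 * a + of_nat k \<noteq> 0" for k using two_a_plus_nat_nonzero[OF a] .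
  have a0: "a \<noteq> 0" using nz[of 0] by simp
  have u1: "fps_nth F 1 = 1 / 2 - \<theta> * p"
  proof -
    have "2 * a * (fps_nth F 1 - (1 / 2 - \<theta> * p)) = 0"
      using coeff[of 0] F0 by (simp add: algebra_simps)
    thus ?thesis using a0 by simp
  qed
  have u2: "fps_nth F 2 = 1 / 2 * ((a + 1) / (2 * (2 * a + 1)) - \<theta> * p + \<theta>\<^sup>2 * (p - 1) * p)"
  proof -
    have nz1: "2 * a + 1 \<noteq> 0" using nz[of 1] by simp
    have q: "(2 * a + 1) * ((a + 1) / (2 * (2 * a + 1))) = (a + 1) / 2"
      using nz1 by (metis mult.commute nonzero_mult_divide_mult_cancel_right times_divide_eq_right)
    have "2 * (2 * a + 1) * (fps_nth F 2
        - 1 / 2 * ((a + 1) / (2 * (2 * a + 1)) - \<theta> * p + \<theta>\<^sup>2 * (p - 1) * p)) = 0"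
      using coeff[of 1] F0 u1 q by (simp add: eval_nat_numeral) algebra
    thus ?thesis using nz1 by (metis mult_eq_0_iff right_minus_eq zero_neq_numeral)
  qed
  have rec: "fps_nth F (Suc (Suc (Suc m))) = beta0 a \<theta> p (Suc (Suc m)) * fps_nth F (Suc (Suc m))
     + beta1 a \<theta> p (Suc (Suc m)) * fps_nth F (Suc m) + beta2 a \<theta> p (Suc (Suc m)) * fps_nth F m" for m
  proof -
    define N :: complex where "N = of_nat (Suc (Suc m))"
    have N: "of_nat (Suc m) = N - 1" "of_nat m = N - 2" "of_nat (Suc (Suc (Suc m))) = N + 1"
      by (simp_all add: N_def)
    \<comment> \<open>The terms \<open>z\<^sup>3 F''\<close> and \<open>z\<^sup>3 F'\<close> have no coefficient at index \<open>2\<close>; the factor \<open>N - 2\<close> agrees.\<close>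
    have shift: "(if m = 0 then 0 else fps_nth ?F'' (m - 1)) = (N - 2) * ((N - 1) * fps_nth F (Suc m))"
      "(if m = 0 then 0 else fps_nth ?F' (m - 1)) = (N - 2) * fps_nth F m"
      unfolding N(1,2)[symmetric] by (cases m; simp)+
    define D where "D = (N + 1) * (2 * a + N)"
    have D: "D \<noteq> 0"
      using nz[of "Suc (Suc m)"] of_nat_neq_0[of "Suc (Suc m)", where 'a = complex]
      unfolding D_def N N_def[symmetric] by simp
    have "fps_nth F (Suc (Suc (Suc m))) * D =
       (a + 2 * \<theta> * N * (2 * a + N - 1) - \<theta> * p * (2 * a + 2 * N) + N) * fps_nth F (Suc (Suc m))
       + \<theta> * (- 2 * a - \<theta> * (N - p - 1) * (2 * a + N - p - 2) - 2 * N + p + 2) * fps_nth F (Suc m)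
       + \<theta>\<^sup>2 * (a + N - p - 2) * fps_nth F m"
      using coeff[of "Suc (Suc m)"]
      by (simp add: mult.assoc shift N N_def[symmetric] del: of_nat_Suc) (unfold D_def, algebra)
    from eq_divide_imp[OF D this] show ?thesis
      unfolding beta0_def beta1_def beta2_def N_def[symmetric] D_def[symmetric]
      by (simp only: times_divide_eq_left flip: add_divide_distrib)
  qed
  show ?thesis
  proof (induction n rule: kummer_u.induct[of "\<lambda>_ _ _ n. fps_nth F n = kummer_u a \<theta> p n" a \<theta> p])
    case 1 show ?case by (simp add: F0)
  next
    case 2 show ?case using u1 by simp
  next
    case 3 show ?case using u2 by (simp add: eval_nat_numeral)
  next
    case (4 a' \<theta>' p' n) thus ?case by (simp add: rec)
  qed
qed

section \<open>Convergence\<close>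

lemma eval_reduced_bessel_series:
  fixes a z :: complex
  shows "(\<lambda>m. (z / 4) ^ (2 * m) / (fact m * pochhammer (a + 1 / 2) m)) sums
           eval_fps (reduced_bessel_series a) z" (is ?sums)
    and "fps_conv_radius (reduced_bessel_series a) = \<infinity>" (is ?radius)
proof -
  have eq: "((\<lambda>m. (z / 4) ^ (2 * m) / (fact m * pochhammer (a + 1 / 2) m)) sums s) \<longleftrightarrow>
      (\<lambda>n. fps_nth (reduced_bessel_series a) n * z ^ n) sums s" for z s
  proof -
    have "16 ^ m = (4 :: complex) ^ (2 * m)" for m by (simp add: power_mult)
    hence terms: "(\<lambda>m. (z / 4) ^ (2 * m) / (fact m * pochhammer (a + 1 / 2) m)) =
        (\<lambda>m. fps_nth (reduced_bessel_series a) (2 * m) * z ^ (2 * m))"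
      by (simp add: reduced_bessel_series_def power_divide fun_eq_iff)
    show ?thesis unfolding terms
    proof (rule sums_mono_reindex)
      show "strict_mono (\<lambda>m :: nat. 2 * m)" by (simp add: strict_mono_def)
      show "fps_nth (reduced_bessel_series a) n * z ^ n = 0" if "n \<notin> range (\<lambda>m. 2 * m)" for n
        using that by (auto simp: reduced_bessel_series_def elim!: evenE)
    qed
  qed
  have "summable (\<lambda>m. (z / 4) ^ (2 * m) / (fact m * pochhammer (a + 1 / 2) m))" for z
  proof -
    define b w where "b = a + 1 / 2" and "w = (z / 4) ^ 2"
    define t where "t m = (z / 4) ^ (2 * m) / (fact m * pochhammer b m)" for m
    have t_Suc: "t (Suc m) = t m * (w / (of_nat (Suc m) * (b + of_nat m)))" for m
      by (simp add: t_def w_def power_add power2_eq_square pochhammer_Suc field_simps)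
    \<comment> \<open>The threshold makes \<open>\<bar>b + m\<bar> \<ge> 1\<close> and \<open>m + 1 \<ge> 2 \<bar>w\<bar>\<close>, so that the ratio is at most \<open>1 / 2\<close>.\<close>
    have "norm (t (Suc m)) \<le> 1 / 2 * norm (t m)" if m: "m \<ge> nat \<lceil>norm b + 1 + 2 * norm w\<rceil>" for m
    proof -
      have m': "real m \<ge> norm b + 1 + 2 * norm w" using m by linarith
      have "real m - norm b \<le> norm (b + of_nat m)"
        using norm_diff_ineq[of "of_nat m" b] by (simp add: add.commute)
      hence "norm (b + of_nat m) \<ge> 1" using m' norm_ge_zero[of w] by linarith
      moreover have "real (Suc m) \<ge> 2 * norm w" using m' norm_ge_zero[of b]
        unfolding of_nat_Suc by linarith
      ultimately have "2 * norm w * 1 \<le> real (Suc m) * norm (b + of_nat m)"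
        by (intro mult_mono) auto
      moreover have "real (Suc m) * norm (b + of_nat m) > 0"
        using \<open>norm (b + of_nat m) \<ge> 1\<close> by (intro mult_pos_pos) auto
      ultimately have "norm w / (real (Suc m) * norm (b + of_nat m)) \<le> 1 / 2"
        by (simp only: pos_divide_le_eq)
      hence "norm (w / (of_nat (Suc m) * (b + of_nat m))) \<le> 1 / 2"
        by (simp only: norm_divide norm_mult norm_of_nat)
      from mult_left_mono[OF this norm_ge_zero[of "t m"]] show ?thesis
        unfolding t_Suc norm_mult by simp
    qed
    hence "summable t" by (intro summable_ratio_test[of "1 / 2"]) (simp, blast)
    thus ?thesis by (simp add: t_def[abs_def] b_def)
  qed
  hence sm: "summable (\<lambda>n. fps_nth (reduced_bessel_series a) n * z ^ n)" for z
    using eq unfolding summable_def by blast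
  show ?radius unfolding fps_conv_radius_def by (rule conv_radius_inftyI'') (rule sm)
  then show ?sums unfolding eq by (intro sums_eval_fps) simp
qed

lemma eval_binomial_series:
  assumes "norm (\<theta> * z) < 1"
  shows "eval_fps (binomial_series \<theta> p) z = (1 - \<theta> * z) powr p" (is ?eval)
    and "norm z < fps_conv_radius (binomial_series \<theta> p)" (is ?radius)
proof -
  have power: "(- (\<theta> * w)) ^ n = (- \<theta>) ^ n * w ^ n" for w n
    by (simp flip: power_mult_distrib)
  have sums: "(\<lambda>n. fps_nth (binomial_series \<theta> p) n * w ^ n) sums (1 - \<theta> * w) powr p"
    if "norm (\<theta> * w) < 1" for w :: complex
    using gen_binomial_complex[of "- (\<theta> * w)" p] that
    by (simp add: binomial_series_def power mult.assoc)
  show ?eval using sums_unique[OF sums[OF assms]] by (simp add: eval_fps_def)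
  \<comment> \<open>Convergence at a point of modulus \<open>r > \<bar>z\<bar>\<close> gives the strict inequality for the radius.\<close>
  obtain r where r: "norm z < r" "norm \<theta> * r < 1"
  proof (cases "\<theta> = 0")
    case True thus ?thesis using that[of "norm z + 1"] by simp
  next
    case False
    hence "norm z < 1 / norm \<theta>" using assms by (simp add: norm_mult field_simps)
    then obtain r where "norm z < r" "r < 1 / norm \<theta>" using dense by blast
    thus ?thesis using that[of r] False by (simp add: field_simps)
  qed
  have "r \<ge> 0" using r(1) norm_ge_zero[of z] by linarith
  hence "summable (\<lambda>n. fps_nth (binomial_series \<theta> p) n * of_real r ^ n)"
    using sums[of "of_real r"] r(2) by (auto simp: norm_mult sums_iff)
  from conv_radius_geI[OF this] have "ereal r \<le> fps_conv_radius (binomial_series \<theta> p)"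
    using \<open>r \<ge> 0\<close> by (simp add: fps_conv_radius_def)
  with r(1) show ?radius by (meson ereal_less(3) less_ereal.simps(1) less_le_trans)
qed

section \<open>The Bessel function\<close>

text \<open>
  The side condition matters only at \<open>z = 0\<close>: if \<open>n > 0\<close> and \<open>n + w = 0\<close> the left-hand side is \<open>1\<close>,
  the right-hand side \<open>0\<close>. For \<open>w = a - 1 / 2\<close> this would force \<open>- 2 a = 2 n - 1\<close>.
\<close>

lemma cpow_add_nat:
  assumes "n = 0 \<or> of_nat n + w \<noteq> 0"
  shows "cpow z (of_nat n + w) = z ^ n * cpow z w"
  using assms by (cases "z = 0") (auto simp: cpow_def powr_add powr_nat power_0_left)

lemma cpow_divide_4: "cpow (z / 4) w = 4 powr (- w) * cpow z w"
proof -
  have "z powr w = 4 powr w * (z / 4) powr w"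
    using powr_times_real_left[of 4 "z / 4" w] by simp
  hence "(z / 4) powr w = 4 powr (- w) * z powr w"
    by (simp add: powr_minus)
  thus ?thesis by (auto simp: cpow_def)
qed

lemma bessel_exponent_nonzero:
  fixes a :: complex
  assumes "- 2 * a \<notin> \<nat>"
  shows "n = 0 \<or> of_nat n + (a - 1 / 2) \<noteq> 0"
proof (cases n)
  case (Suc k)
  thus ?thesis using a_plus_half_plus_nat_nonzero[OF assms, of k] by (simp add: algebra_simps)
qed simp

text \<open>
  With \<open>\<Gamma>(m + a + 1/2) = (a + 1/2)\<^sub>m \<Gamma>(a + 1/2)\<close>, the common factor
  \<open>(z / 4) powr (a - 1/2) / \<Gamma>(a + 1/2)\<close> leaves the sum.
\<close>

lemma bessel_I_eq_reduced_bessel_series: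
  assumes a: "- 2 * a \<notin> \<nat>"
  shows "bessel_I (a - 1 / 2) (z / 2) =
    4 powr (1 / 2 - a) / Gamma (a + 1 / 2) * cpow z (a - 1 / 2) * eval_fps (reduced_bessel_series a) z"
proof -
  let ?C = "4 powr (1 / 2 - a) / Gamma (a + 1 / 2) * cpow z (a - 1 / 2)"
  have b: "a + 1 / 2 \<notin> \<int>\<^sub>\<le>\<^sub>0"
    using a_plus_half_plus_nat_nonzero[OF a] by (metis nonpos_Ints_cases' add.left_inverse)
  have summand: "(1 :: complex) / (fact m * Gamma (of_nat m + (a - 1 / 2) + 1))
        * cpow (z / 2 / 2) (2 * of_nat m + (a - 1 / 2))
      = ?C * ((z / 4) ^ (2 * m) / (fact m * pochhammer (a + 1 / 2) m))" for m
  proof -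
    have "of_nat m + (a - 1 / 2) + 1 = a + 1 / 2 + of_nat m" by (simp add: field_simps)
    moreover have "Gamma (a + 1 / 2 + of_nat m) = pochhammer (a + 1 / 2) m * Gamma (a + 1 / 2)"
      using b by (simp add: pochhammer_Gamma Gamma_eq_zero_iff)
    ultimately have Gamma: "Gamma (of_nat m + (a - 1 / 2) + 1) =
        pochhammer (a + 1 / 2) m * Gamma (a + 1 / 2)" by (simp only:)
    have cpow: "cpow (z / 2 / 2) (2 * of_nat m + (a - 1 / 2)) =
        (z / 4) ^ (2 * m) * (4 powr (1 / 2 - a) * cpow z (a - 1 / 2))"
      using cpow_add_nat[OF bessel_exponent_nonzero[OF a, of "2 * m"], of "z / 4"]
      by (simp add: cpow_divide_4)
    show ?thesis unfolding Gamma cpow by (simp add: mult_ac)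
  qed
  show ?thesis
    unfolding bessel_I_def summand
    by (rule sums_unique[symmetric]) (rule sums_mult, rule eval_reduced_bessel_series)
qed

text \<open>
  The sum over \<open>k\<close> in \<^const>\<open>bessel_coeff\<close> is the Cauchy product of \<open>exp (- z / 2)\<close> with \<open>F\<close>; the
  exponential cancels the one contained in \<open>F\<close>.
\<close>

lemma bessel_coeff_eq_fps_nth:
  assumes a: "- 2 * a \<notin> \<nat>"
  shows "bessel_coeff a \<theta> p n = 4 powr (1 / 2 - a) / Gamma (a + 1 / 2) *
           fps_nth (binomial_series \<theta> p * reduced_bessel_series a) n"
proof -
  define F where "F = binomial_series \<theta> p * (fps_exp (1 / 2) * reduced_bessel_series a)"
  have "fps_nth F 0 = 1"
    by (simp add: F_def binomial_series_def reduced_bessel_series_def)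
  hence u: "fps_nth F k = kummer_u a \<theta> p k" for k
    using fps_solution_eq_kummer_u[OF a]
      binomial_times_deriv2[OF exp_times_deriv2[OF reduced_bessel_series_deriv2[OF a]]]
    unfolding F_def by blast
  have "fps_exp (- (1 / 2)) * fps_exp (1 / 2) = (1 :: complex fps)"
    by (subst fps_exp_add_mult[symmetric]) simp
  hence "binomial_series \<theta> p * reduced_bessel_series a = fps_exp (- (1 / 2)) * F"
    unfolding F_def by algebra
  also have "fps_nth \<dots> n = (\<Sum>k=0..n. (-1) ^ k * kummer_u a \<theta> p (n - k) / (2 ^ k * fact k))"
    unfolding fps_mult_nth
    by (intro sum.cong refl) (simp add: u power_minus[of "1 / 2"] power_divide)
  finally show ?thesis by (simp add: bessel_coeff_def)
qed

theorem corollary4p4: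
  fixes a \<theta> p z :: complex
  assumes "- 2 * a \<notin> \<nat>"
    and "\<theta> \<noteq> 0 \<longrightarrow> cmod z < 1 / cmod \<theta>"
    and "\<bar>Arg (1 - \<theta> * z)\<bar> < pi"
  shows "(\<lambda>n. bessel_coeff a \<theta> p n * cpow z (of_nat n + a - 1 / 2)) sums
           ((1 - \<theta> * z) powr p * bessel_I (a - 1 / 2) (z / 2))"
proof -
  let ?B = "binomial_series \<theta> p" and ?K = "reduced_bessel_series a"
  let ?C = "4 powr (1 / 2 - a) / Gamma (a + 1 / 2)"
  note a = assms(1)
  have small: "norm (\<theta> * z) < 1"
    using assms(2) by (cases "\<theta> = 0") (auto simp: norm_mult field_simps)
  have rB: "norm z < fps_conv_radius ?B" by (rule eval_binomial_series[OF small])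
  have rK: "norm z < fps_conv_radius ?K" by (simp add: eval_reduced_bessel_series)
  have "norm z < fps_conv_radius (?B * ?K)"
    using fps_conv_radius_mult[of ?B ?K] rB rK by (meson less_le_trans min_less_iff_conj)
  from sums_eval_fps[OF this]
  have "(\<lambda>n. fps_nth (?B * ?K) n * z ^ n) sums ((1 - \<theta> * z) powr p * eval_fps ?K z)"
    by (simp add: eval_fps_mult[OF rB rK] eval_binomial_series[OF small])
  from sums_mult[OF this, of "?C * cpow z (a - 1 / 2)"]
  show ?thesis
    using cpow_add_nat[OF bessel_exponent_nonzero[OF a]]
    by (simp add: bessel_coeff_eq_fps_nth[OF a] bessel_I_eq_reduced_bessel_series[OF a]
        add_diff_eq[symmetric] mult_ac)
qed

end
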